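(* Let $n\ge 2$ be an integer, let $k>0$, $a>0$, $b-a>0$, $\eta>0$ and $\zeta\ge 0$ be real numbers. Then for all $\phi,\psi\in(0,\infty)^n$, $$\left(\beta_{\zeta,k}^{(a,b)}(\phi+\psi;\eta)\right)^2\le \beta_{\zeta,k}^{(a,b)}(2\phi;\eta)\,\beta_{\zeta,k}^{(a,b)}(2\psi;\eta).$$ Moreover, the real-valued function $\phi\mapsto\beta_{\zeta,k}^{(a,b)}(\phi;\eta)$ is convex on $(0,\infty)^n$.
   Context: $E_{n-1}=\{(t_1,\dots,t_{n-1})\in\mathbb{R}^{n-1}: t_i\ge 0,\ \sum_{i=1}^{n-1}t_i\le 1\}$; for $t\in E_{n-1}$ put $t_n=1-\sum_{i=1}^{n-1}t_i$, $\pi(t)=\prod_{i=1}^n t_i$, $dt=dt_1\cdots dt_{n-1}$. For $c>0$, $(c)_{0,k}=1$ and $(c)_{m,k}=c(c+k)\cdots(c+(m-1)k)$ for $m\ge1$ (Pochhammer $k$-symbol). The confluent hypergeometric $k$-function is ${}_1F_{1,k}(a;b;x)=\sum_{m=0}^\infty \frac{(a)_{m,k}}{(b)_{m,k}}\frac{x^m}{m!}$, $x\in\mathbb{R}$. The generalized beta $k$-function of the first kind is, for $\phi=(\phi_1,\dots,\phi_n)\in(0,\infty)^n$, $$\beta_{\zeta,k}^{(a,b)}(\phi;\eta)=\frac1{k^{n-1}}\int_{E_{n-1}}\prod_{i=1}^n t_i^{\frac{\phi_i}{k}-1}\;{}_1F_{1,k}\!\left(a;b;-\frac{\eta^k}{k\pi(t)}-\zeta^k\frac{\pi(t)}{\eta^k}\right)dt.$$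 *)

theory Defs
  imports "HOL-Analysis.Analysis"
begin

text \<open>
  With \<open>n - 1 = CARD('m)\<close>, the index set \<open>{1, ..., n}\<close> is rendered as \<open>'m option\<close>: the indices
  \<open>Some i\<close> are the first \<open>n - 1\<close> ones and \<open>None\<close> is the last index \<open>n\<close>. As \<open>'m\<close> ranges over all
  (nonempty) finite types, \<open>n = CARD('m option)\<close> ranges over all integers \<open>n \<ge> 2\<close>.
\<close>

definition pochhammer_k :: "real \<Rightarrow> nat \<Rightarrow> real \<Rightarrow> real" where
  "pochhammer_k c m k = (\<Prod>j<m. c + real j * k)"

definition hyp1F1_k :: "real \<Rightarrow> real \<Rightarrow> real \<Rightarrow> real \<Rightarrow> real" where
  "hyp1F1_k k a b x = (\<Sum>m. pochhammer_k a m k / pochhammer_k b m k * (x ^ m / fact m))"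

definition E_simplex :: "(real ^ 'm) set" where
  "E_simplex = {t. (\<forall>i. t $ i \<ge> 0) \<and> (\<Sum>i\<in>UNIV. t $ i) \<le> 1}"

definition full_coords :: "real ^ 'm \<Rightarrow> real ^ 'm option" where
  "full_coords t = (\<chi> i. case i of Some j \<Rightarrow> t $ j | None \<Rightarrow> 1 - (\<Sum>j\<in>UNIV. t $ j))"

definition coord_prod :: "real ^ 'm \<Rightarrow> real" where
  "coord_prod t = (\<Prod>i\<in>UNIV. full_coords t $ i)"

text \<open>
  Where \<open>coord_prod t = 0\<close>, i.e. on the boundary of the simplex, the integrand takes a junk value;
  this is a null set. For \<open>\<zeta> = 0\<close> we have \<open>\<zeta> powr k = 0\<close>, as intended.
\<close>

definition gen_beta_k ::
    "real \<Rightarrow> real \<Rightarrow> real \<Rightarrow> real \<Rightarrow> real ^ ('m::finite) option \<Rightarrow> real \<Rightarrow> real" where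
  "gen_beta_k \<zeta> k a b \<phi> \<eta> =
     1 / k ^ CARD('m::finite) *
     (LINT t:(E_simplex :: (real ^ ('m::finite)) set)|lborel.
        (\<Prod>i\<in>UNIV. full_coords t $ i powr (\<phi> $ i / k - 1)) *
        hyp1F1_k k a b
          (- (\<eta> powr k / (k * coord_prod t)) - \<zeta> powr k * (coord_prod t / \<eta> powr k)))"

definition pos_orthant :: "(real ^ 'n) set" where
  "pos_orthant = {\<phi>. \<forall>i. \<phi> $ i > 0}"

end

(* Writing p = a/k and q = (b - a)/k, the coefficients (a)_{m,k}/(b)_{m,k} are the moments of the
   Beta(p, q) distribution, so 1F1_k is the average of exp(x u) over u in [0, 1] with respect to
   that distribution and takes values in [0, 1] for x <= 0. Hence the integrand of the beta
   k-function is dominated by a Dirichlet density, which is integrable, and is a nonnegative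
   weight times a kernel that is log-linear in phi. The inequality is Cauchy-Schwarz, and convexity
   follows from that of exp. *)

theory Submission
  imports Defs
begin

section \<open>Euler integral of the confluent hypergeometric k-function and its bounds\<close>

lemma pochhammer_k_ratio:
  fixes k a b :: real
  assumes "k > 0" "a > 0" "b - a > 0"
  shows "pochhammer_k a m k / pochhammer_k b m k * Beta (a / k) ((b - a) / k) =
    Beta (a / k + real m) ((b - a) / k)"
proof (induction m)
  case 0
  then show ?case by (simp add: pochhammer_k_def)
next
  case (Suc m)
  have pos: "a / k + real m > 0" "b + real m * k > 0"
    using assms by (auto intro!: add_pos_nonneg)
  \<comment> \<open>The recurrence (p + q) B(p + 1, q) = p B(p, q), with p = a/k + m and q = (b -
    a)/k. Clearing the denominator k turns its two factors into the new factors b + mk and a + mk of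
    the Pochhammer symbols.\<close>
  have "(a / k + real m + (b - a) / k) * Beta (a / k + real m + 1) ((b - a) / k) =
      (a / k + real m) * Beta (a / k + real m) ((b - a) / k)"
    by (rule Beta_plus1_left) (use pos in \<open>auto elim!: nonpos_Ints_cases\<close>)
  moreover have "a / k + real m + (b - a) / k = (b + real m * k) / k"
    "a / k + real m = (a + real m * k) / k"
    using assms by (simp_all add: field_simps)
  ultimately have "(b + real m * k) * Beta (a / k + real m + 1) ((b - a) / k) =
      (a + real m * k) * Beta (a / k + real m) ((b - a) / k)"
    using assms by (metis less_irrefl nonzero_mult_div_cancel_right times_divide_eq_left divide_cancel_right)
  with pos have "Beta (a / k + real m + 1) ((b - a) / k) =
      (a + real m * k) / (b + real m * k) * Beta (a / k + real m) ((b - a) / k)"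
    by (simp add: field_simps)
  moreover have "pochhammer_k a (Suc m) k / pochhammer_k b (Suc m) k =
      (a + real m * k) / (b + real m * k) * (pochhammer_k a m k / pochhammer_k b m k)"
    by (simp add: pochhammer_k_def mult_ac)
  ultimately show ?case
    using Suc by (simp only: of_nat_Suc mult.assoc add_ac)
qed

lemma Beta_pos_real:
  fixes p q :: real
  assumes "p > 0" "q > 0"
  shows "Beta p q > 0"
  using assms by (simp add: Beta_def Gamma_real_pos)

lemma has_bochner_integral_Beta:
  fixes p q :: real
  assumes "p > 0" "q > 0"
  shows "has_bochner_integral lborel
    (\<lambda>u. indicator {0..1} u * (u powr (p - 1) * (1 - u) powr (q - 1))) (Beta p q)"
  using set_borel_integral_eq_integral[OF integrable_Beta[OF assms]] integrable_Beta[OF assms]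
    has_integral_Beta_real[OF assms]
  by (simp add: has_bochner_integral_iff set_integrable_def set_lebesgue_integral_def integral_unique)

lemma has_bochner_integral_Beta_moment:
  fixes p q :: real
  assumes "p > 0" "q > 0"
  shows "has_bochner_integral lborel
    (\<lambda>u. indicator {0..1} u * (u powr (p - 1) * (1 - u) powr (q - 1)) * ((x * u) ^ m / fact m))
    (Beta (p + real m) q * (x ^ m / fact m))"
proof -
  \<comment> \<open>At u = 0 both sides are 0, since \<open>0 powr y = 0\<close> whatever the sign
    of y.\<close>
  have eq: "u powr (p + real m - 1) = u powr (p - 1) * u ^ m" if "u \<ge> 0" for u :: real
    using that by (cases "u = 0") (auto simp: powr_add powr_diff powr_realpow)
  have "has_bochner_integral lborel
     (\<lambda>u. indicator {0..1} u * (u powr (p + real m - 1) * (1 - u) powr (q - 1)) * (x ^ m / fact m))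
     (Beta (p + real m) q * (x ^ m / fact m))"
    by (intro has_bochner_integral_mult_left has_bochner_integral_Beta) (use assms in auto)
  moreover have "(\<lambda>u. indicator {0..1} u * (u powr (p + real m - 1) * (1 - u) powr (q - 1)) * (x ^ m / fact m)) =
     (\<lambda>u. indicator {0..1} u * (u powr (p - 1) * (1 - u) powr (q - 1)) * ((x * u) ^ m / fact m))"
    by (rule ext) (auto simp: indicator_def eq power_mult_distrib)
  ultimately show ?thesis by simp
qed

text \<open>Each unit step multiplies the value by (p + m)/(p + m + q) < 1. This gives a bound
  uniform in m for dominating the series of moments.\<close>

lemma Beta_add_left_le:
  fixes p q :: real
  assumes "p > 0" "q > 0"
  shows "Beta (p + real m) q \<le> Beta p q"
proof (induction m)
  case (Suc m)
  have pos: "p + real m > 0" using assms by auto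
  have "(p + real m + q) * Beta (p + real m + 1) q = (p + real m) * Beta (p + real m) q"
    by (rule Beta_plus1_left) (use pos in \<open>auto elim!: nonpos_Ints_cases\<close>)
  also have "\<dots> \<le> (p + real m + q) * Beta (p + real m) q"
    using Beta_pos_real[OF pos assms(2)] assms by (intro mult_right_mono) auto
  finally have "Beta (p + real m + 1) q \<le> Beta (p + real m) q"
    using pos assms by (simp add: mult_le_cancel_left_pos)
  with Suc show ?case by (simp add: add_ac)
qed simp

text \<open>Expand \<open>exp (x * u)\<close> in powers of u and integrate term by term against the
  Beta weight: the m-th moment, divided by \<open>Beta p q\<close>, is the m-th coefficient
  ratio.\<close>

lemma hyp1F1_k_integral_representation:
  fixes k a b x :: real
  assumes "k > 0" "a > 0" "b - a > 0"
  defines "p \<equiv> a / k" and "q \<equiv> (b - a) / k"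
  shows "integrable lborel
      (\<lambda>u. indicator {0..1} u * (u powr (p - 1) * (1 - u) powr (q - 1)) * exp (x * u))"
    and "hyp1F1_k k a b x * Beta p q =
      (\<integral>u. indicator {0..1} u * (u powr (p - 1) * (1 - u) powr (q - 1)) * exp (x * u) \<partial>lborel)"
proof -
  have pq: "p > 0" "q > 0" using assms by auto
  define W where "W = (\<lambda>u::real. indicator {0..1} u * (u powr (p - 1) * (1 - u) powr (q - 1)))"
  define f where "f = (\<lambda>m u. W u * ((x * u) ^ m / fact m))"
  have W_nonneg: "W u \<ge> 0" for u by (simp add: W_def)
  have exp_sums: "(\<lambda>m. y ^ m / fact m) sums exp y" for y :: real
    using exp_converges[of y] by (simp add: divide_inverse_commute)
  have f_int: "has_bochner_integral lborel (f m) (Beta (p + real m) q * (x ^ m / fact m))" for m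
    unfolding f_def W_def by (rule has_bochner_integral_Beta_moment[OF pq])
  \<comment> \<open>The weight is supported in [0, 1], so taking norms only replaces
    \<open>x\<close> by its absolute value, and the moment formula also computes the L1
    norms.\<close>
  have norm_f: "norm (f m u) = W u * ((\<bar>x\<bar> * u) ^ m / fact m)" for m u
    by (auto simp: f_def W_def indicator_def abs_mult power_abs power_mult_distrib)
  have norm_int: "(\<integral>u. norm (f m u) \<partial>lborel) = Beta (p + real m) q * (\<bar>x\<bar> ^ m / fact m)" for m
    unfolding norm_f W_def
    by (rule has_bochner_integral_integral_eq[OF has_bochner_integral_Beta_moment[OF pq]])
  have f_sums: "(\<lambda>m. f m u) sums (W u * exp (x * u))" for u
    unfolding f_def by (intro sums_mult exp_sums)
  have int: "integrable lborel (f m)" for m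
    using f_int by (auto simp: has_bochner_integral_iff)
  have 1: "AE u in lborel. summable (\<lambda>m. norm (f m u))"
    unfolding norm_f by (intro AE_I2 summable_mult sums_summable[OF exp_sums])
  \<comment> \<open>Summability of the L1 norms justifies the termwise integration; the majorant
    sums to \<open>Beta p q\<close> times exp |x|.\<close>
  have 2: "summable (\<lambda>m. \<integral>u. norm (f m u) \<partial>lborel)"
    unfolding norm_int
  proof (rule summable_comparison_test')
    show "summable (\<lambda>m. Beta p q * (\<bar>x\<bar> ^ m / fact m))"
      by (intro summable_mult sums_summable[OF exp_sums])
    show "norm (Beta (p + real m) q * (\<bar>x\<bar> ^ m / fact m)) \<le> Beta p q * (\<bar>x\<bar> ^ m / fact m)" for m
      using Beta_add_left_le[OF pq, of m] Beta_pos_real[of "p + real m" q] pq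
      by (auto simp: abs_mult intro!: divide_right_mono mult_right_mono)
  qed
  have suminf_f: "(\<lambda>u. \<Sum>m. f m u) = (\<lambda>u. W u * exp (x * u))"
    using f_sums by (simp add: sums_iff)
  show "integrable lborel
      (\<lambda>u. indicator {0..1} u * (u powr (p - 1) * (1 - u) powr (q - 1)) * exp (x * u))"
    using integrable_suminf[OF int 1 2] unfolding suminf_f W_def .
  have "(\<lambda>m. Beta (p + real m) q * (x ^ m / fact m)) sums (\<integral>u. W u * exp (x * u) \<partial>lborel)"
    using sums_integral[OF int 1 2] unfolding suminf_f
    by (simp add: has_bochner_integral_integral_eq[OF f_int])
  from sums_divide[OF this, of "Beta p q"]
  have "(\<lambda>m. pochhammer_k a m k / pochhammer_k b m k * (x ^ m / fact m)) sums
      ((\<integral>u. W u * exp (x * u) \<partial>lborel) / Beta p q)"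
    using Beta_pos_real[OF pq]
    by (simp add: p_def q_def pochhammer_k_ratio[OF assms(1-3), symmetric] mult_ac)
  then have "hyp1F1_k k a b x = (\<integral>u. W u * exp (x * u) \<partial>lborel) / Beta p q"
    by (simp add: hyp1F1_k_def sums_iff)
  then show "hyp1F1_k k a b x * Beta p q =
      (\<integral>u. indicator {0..1} u * (u powr (p - 1) * (1 - u) powr (q - 1)) * exp (x * u) \<partial>lborel)"
    using Beta_pos_real[OF pq] by (simp add: W_def)
qed

lemma hyp1F1_k_nonneg:
  fixes k a b x :: real
  assumes "k > 0" "a > 0" "b - a > 0"
  shows "0 \<le> hyp1F1_k k a b x"
proof -
  have "0 \<le> hyp1F1_k k a b x * Beta (a / k) ((b - a) / k)"
    unfolding hyp1F1_k_integral_representation(2)[OF assms] by (intro Bochner_Integration.integral_nonneg) auto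
  with Beta_pos_real[of "a / k" "(b - a) / k"] assms show ?thesis
    by (simp add: zero_le_mult_iff)
qed

text \<open>For x <= 0 the exponential is at most 1 on [0, 1], so the integral is at most the total
  mass of the Beta weight.\<close>

lemma hyp1F1_k_le_1:
  fixes k a b x :: real
  assumes "k > 0" "a > 0" "b - a > 0" "x \<le> 0"
  shows "hyp1F1_k k a b x \<le> 1"
proof -
  have pq: "a / k > 0" "(b - a) / k > 0" using assms by auto
  note B = has_bochner_integral_Beta[OF pq]
  have "hyp1F1_k k a b x * Beta (a / k) ((b - a) / k) \<le> Beta (a / k) ((b - a) / k)"
    unfolding hyp1F1_k_integral_representation(2)[OF assms(1-3)]
    unfolding has_bochner_integral_integral_eq[OF B, symmetric]
  proof (rule integral_mono)
    fix u :: real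
    show "indicator {0..1} u * (u powr (a / k - 1) * (1 - u) powr ((b - a) / k - 1)) * exp (x * u)
      \<le> indicator {0..1} u * (u powr (a / k - 1) * (1 - u) powr ((b - a) / k - 1))"
      using assms(4) by (auto simp: indicator_def mult_le_0_iff intro!: mult_left_le)
  qed (use B hyp1F1_k_integral_representation(1)[OF assms(1-3)] in \<open>auto simp: has_bochner_integral_iff\<close>)
  with Beta_pos_real[OF pq] show ?thesis by simp
qed

lemma borel_measurable_hyp1F1_k [measurable]: "hyp1F1_k k a b \<in> borel_measurable borel"
  unfolding hyp1F1_k_def[abs_def] by measurable

section \<open>Finiteness of the Dirichlet integral\<close>

text \<open>
  Extending the power by zero to the negative axis encodes the constraints of the simplex in the
  integrand, so that the Dirichlet integral becomes an iterated convolution over the whole line.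
\<close>

definition pos_powr :: "real \<Rightarrow> real \<Rightarrow> real" where
  "pos_powr a x = indicator {0<..} x * x powr (a - 1)"

lemma borel_measurable_pos_powr [measurable]: "pos_powr a \<in> borel_measurable borel"
  unfolding pos_powr_def[abs_def] by measurable

lemma pos_powr_nonneg [simp]: "pos_powr a x \<ge> 0"
  by (simp add: pos_powr_def)

lemma pos_powr_eq: "x \<ge> 0 \<Longrightarrow> pos_powr a x = x powr (a - 1)"
  by (auto simp: pos_powr_def indicator_def)

text \<open>For s > 0 the substitution t = s u pulls out a power of s and leaves the Beta integral;
  for s <= 0 the supports of the two factors do not meet.\<close>

lemma nn_integral_pos_powr_convolution:
  fixes a b s :: real
  assumes "a > 0" "b > 0"
  shows "(\<integral>\<^sup>+t. ennreal (pos_powr a t * pos_powr b (s - t)) \<partial>lborel) =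
    ennreal (Beta a b * pos_powr (a + b) s)"
proof (cases "s > 0")
  case False
  then have "pos_powr a t * pos_powr b (s - t) = 0" for t
    by (auto simp: pos_powr_def indicator_def)
  then have "(\<integral>\<^sup>+t. ennreal (pos_powr a t * pos_powr b (s - t)) \<partial>lborel) = 0"
    by (simp only: ennreal_0 nn_integral_const mult_zero_left)
  with False show ?thesis by (simp add: pos_powr_def)
next
  case True
  have eq: "pos_powr a (s * u) * pos_powr b (s - s * u) =
      s powr (a + b - 2) * (indicator {0..1} u * (u powr (a - 1) * (1 - u) powr (b - 1)))" for u
  proof (cases "0 < u \<and> u < 1")
    case u: True
    have "s - s * u = s * (1 - u)" by (simp add: algebra_simps)
    moreover have "s powr (a + b - 2) = s powr (a - 1) * s powr (b - 1)"
      by (simp add: powr_add[symmetric])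
    ultimately show ?thesis
      using u True by (simp add: pos_powr_def powr_mult mult_pos_pos)
  next
    \<comment> \<open>Both sides vanish: on the left one argument is nonpositive; on the right the
      indicator is 0 or, at the endpoints, a power of 0 appears.\<close>
    case u: False
    then consider "u \<le> 0" | "u \<ge> 1" by linarith
    then show ?thesis
    proof cases
      case 1
      then have "s * u \<le> 0" using True by (simp add: mult_le_0_iff)
      with 1 show ?thesis by (cases "u = 0") (auto simp: pos_powr_def)
    next
      case 2
      then have "s * u \<ge> s" using True by simp
      with 2 show ?thesis by (cases "u = 1") (auto simp: pos_powr_def)
    qed
  qed
  have "(\<integral>\<^sup>+u. ennreal (indicator {0..1} u * (u powr (a - 1) * (1 - u) powr (b - 1))) \<partial>lborel) =
      ennreal (Beta a b)"
    using has_bochner_integral_Beta[OF assms]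
    by (subst nn_integral_eq_integral) (auto simp: has_bochner_integral_iff)
  then have "(\<integral>\<^sup>+t. ennreal (pos_powr a t * pos_powr b (s - t)) \<partial>lborel) =
      ennreal s * (ennreal (s powr (a + b - 2)) * ennreal (Beta a b))"
    using True
    by (subst nn_integral_real_affine[where c = s and t = 0])
       (auto simp: eq ennreal_mult' nn_integral_cmult)
  \<comment> \<open>The factor \<open>s powr 1\<close> is the Jacobian; it raises the exponent from
    a + b - 2 to a + b - 1.\<close>
  also have "\<dots> = ennreal (Beta a b * (s powr 1 * s powr (a + b - 2)))"
    using True Beta_pos_real[OF assms] by (simp add: ennreal_mult[symmetric] mult_ac)
  also have "s powr 1 * s powr (a + b - 2) = pos_powr (a + b) s"
    unfolding powr_add[symmetric] using True by (simp add: pos_powr_def)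
  finally show ?thesis .
qed

text \<open>Integrating out one coordinate j is a convolution, which merges its exponent with
  \<open>\<beta>\<close>. The induction therefore runs over arbitrary \<open>\<beta>\<close> and
  uses its hypothesis at \<open>\<alpha> j + \<beta>\<close>.\<close>

lemma nn_integral_PiM_Dirichlet:
  fixes \<alpha> :: "'i \<Rightarrow> real" and \<beta> :: real
  assumes "finite J" "\<And>i. i \<in> J \<Longrightarrow> \<alpha> i > 0" "\<beta> > 0"
  shows "\<exists>C\<ge>0. \<forall>s. (\<integral>\<^sup>+x. ennreal ((\<Prod>i\<in>J. pos_powr (\<alpha> i) (x i)) * pos_powr \<beta> (s - (\<Sum>i\<in>J. x i)))
    \<partial>Pi\<^sub>M J (\<lambda>_. lborel)) = ennreal (C * pos_powr (\<beta> + (\<Sum>i\<in>J. \<alpha> i)) s)"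
  using assms
proof (induction J arbitrary: \<beta> rule: finite_induct)
  case empty
  show ?case by (intro exI[of _ 1]) (simp add: PiM_empty)
next
  case (insert j J)
  interpret product_sigma_finite "\<lambda>_. lborel :: real measure" ..
  have pos: "\<alpha> j > 0" "\<beta> > 0" using insert.prems by auto
  obtain C where C: "C \<ge> 0" and IH:
    "\<And>s. (\<integral>\<^sup>+x. ennreal ((\<Prod>i\<in>J. pos_powr (\<alpha> i) (x i)) * pos_powr (\<alpha> j + \<beta>) (s - (\<Sum>i\<in>J. x i)))
      \<partial>Pi\<^sub>M J (\<lambda>_. lborel)) = ennreal (C * pos_powr (\<alpha> j + \<beta> + (\<Sum>i\<in>J. \<alpha> i)) s)"
    using insert.IH[of "\<alpha> j + \<beta>"] insert.prems pos by (auto simp: add_pos_pos)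
  let ?B = "Beta (\<alpha> j) \<beta>"
  have B: "?B > 0" by (rule Beta_pos_real[OF pos])
  show ?case
  proof (intro exI[of _ "?B * C"] conjI allI)
    fix s
    let ?f = "\<lambda>x. ennreal ((\<Prod>i\<in>insert j J. pos_powr (\<alpha> i) (x i)) * pos_powr \<beta> (s - (\<Sum>i\<in>insert j J. x i)))"
    let ?P = "\<lambda>x. \<Prod>i\<in>J. pos_powr (\<alpha> i) (x i)"
    have upd: "?f (x(j := y)) =
        ennreal (?P x) * ennreal (pos_powr (\<alpha> j) y * pos_powr \<beta> ((s - (\<Sum>i\<in>J. x i)) - y))" for x y
    proof -
      have "(\<Prod>i\<in>J. pos_powr (\<alpha> i) ((x(j := y)) i)) = ?P x" "(\<Sum>i\<in>J. (x(j := y)) i) = (\<Sum>i\<in>J. x i)"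
        using insert.hyps by (auto intro!: prod.cong sum.cong)
      then show ?thesis
        using insert.hyps
        by (simp add: ennreal_mult[symmetric] prod_nonneg algebra_simps del: fun_upd_apply)
           (simp add: algebra_simps)
    qed
    have "(\<integral>\<^sup>+x. ?f x \<partial>Pi\<^sub>M (insert j J) (\<lambda>_. lborel)) =
        (\<integral>\<^sup>+x. (\<integral>\<^sup>+y. ?f (x(j := y)) \<partial>lborel) \<partial>Pi\<^sub>M J (\<lambda>_. lborel))"
      by (rule product_nn_integral_insert) (use insert.hyps in measurable)
    also have "\<dots> = (\<integral>\<^sup>+x. ennreal ?B *
        ennreal (?P x * pos_powr (\<alpha> j + \<beta>) (s - (\<Sum>i\<in>J. x i))) \<partial>Pi\<^sub>M J (\<lambda>_. lborel))"
      unfolding upd using B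
      by (subst nn_integral_cmult)
         (auto simp: nn_integral_pos_powr_convolution[OF pos] ennreal_mult[symmetric] prod_nonneg mult_ac
               intro!: nn_integral_cong)
    also have "\<dots> = ennreal ?B * ennreal (C * pos_powr (\<alpha> j + \<beta> + (\<Sum>i\<in>J. \<alpha> i)) s)"
      by (subst nn_integral_cmult) (simp_all add: IH)
    also have "\<dots> = ennreal (?B * C * pos_powr (\<beta> + (\<Sum>i\<in>insert j J. \<alpha> i)) s)"
      using insert.hyps B C by (simp add: ennreal_mult[symmetric] add_ac mult_ac)
    finally show "(\<integral>\<^sup>+x. ?f x \<partial>Pi\<^sub>M (insert j J) (\<lambda>_. lborel)) =
      ennreal (?B * C * pos_powr (\<beta> + (\<Sum>i\<in>insert j J. \<alpha> i)) s)" .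
  qed (use B C in simp)
qed

text \<open>Lebesgue measure on the vector space is the image of the product measure indexed by
  \<open>Basis\<close>. Relabelling basis vectors as coordinates reduces the claim to the product
  formula at s = 1.\<close>

lemma nn_integral_Dirichlet_finite:
  fixes \<alpha> :: "'m::finite \<Rightarrow> real" and \<beta> :: real
  assumes "\<And>i. \<alpha> i > 0" "\<beta> > 0"
  shows "(\<integral>\<^sup>+t. ennreal ((\<Prod>i\<in>UNIV. pos_powr (\<alpha> i) (t $ i)) *
    pos_powr \<beta> (1 - (\<Sum>i\<in>UNIV. t $ i))) \<partial>(lborel :: (real ^ 'm) measure)) < \<infinity>"
proof -
  let ?Bs = "Basis :: (real ^ 'm) set"
  have bij: "bij_betw (\<lambda>i. axis i 1 :: real ^ 'm) UNIV ?Bs"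
    by (auto simp: bij_betw_def inj_on_def axis_eq_axis Basis_vec_def)
  have comp: "(\<Sum>b\<in>?Bs. f b *\<^sub>R b) $ i = f (axis i 1)" for f i
  proof -
    have "(\<Sum>b\<in>?Bs. f b *\<^sub>R b) $ i = (\<Sum>b\<in>?Bs. f b *\<^sub>R b) \<bullet> axis i 1"
      by (simp add: inner_axis)
    also have "\<dots> = f (axis i 1)"
      by (rule inner_sum_left_Basis) (auto simp: Basis_vec_def)
    finally show ?thesis .
  qed
  obtain C where C: "\<And>s. (\<integral>\<^sup>+x. ennreal ((\<Prod>b\<in>?Bs. pos_powr (\<alpha> (axis_index b)) (x b)) *
      pos_powr \<beta> (s - (\<Sum>b\<in>?Bs. x b))) \<partial>Pi\<^sub>M ?Bs (\<lambda>_. lborel)) =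
      ennreal (C * pos_powr (\<beta> + (\<Sum>b\<in>?Bs. \<alpha> (axis_index b))) s)"
    using nn_integral_PiM_Dirichlet[of ?Bs "\<lambda>b. \<alpha> (axis_index b)" \<beta>] assms by auto
  have "(\<integral>\<^sup>+t. ennreal ((\<Prod>i\<in>UNIV. pos_powr (\<alpha> i) (t $ i)) *
      pos_powr \<beta> (1 - (\<Sum>i\<in>UNIV. t $ i))) \<partial>(lborel :: (real ^ 'm) measure)) =
    (\<integral>\<^sup>+x. ennreal ((\<Prod>i\<in>UNIV. pos_powr (\<alpha> i) (x (axis i 1))) *
      pos_powr \<beta> (1 - (\<Sum>i\<in>UNIV. x (axis i 1)))) \<partial>Pi\<^sub>M ?Bs (\<lambda>_. lborel))"
    by (subst lborel_def) (simp add: nn_integral_distr comp lborel_eq_real del: sum_component)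
  also have "\<dots> = (\<integral>\<^sup>+x. ennreal ((\<Prod>b\<in>?Bs. pos_powr (\<alpha> (axis_index b)) (x b)) *
      pos_powr \<beta> (1 - (\<Sum>b\<in>?Bs. x b))) \<partial>Pi\<^sub>M ?Bs (\<lambda>_. lborel))"
    unfolding prod.reindex_bij_betw[OF bij, symmetric] sum.reindex_bij_betw[OF bij, symmetric]
    by (simp add: axis_index_axis)
  finally show ?thesis by (simp add: C)
qed

section \<open>Cauchy-Schwarz inequality for integrals\<close>

lemma integral_Cauchy_Schwarz:
  fixes f g h :: "'a \<Rightarrow> real"
  assumes "integrable M f" "integrable M g" "integrable M h"
    and "\<And>x. x \<in> space M \<Longrightarrow> 0 \<le> f x" "\<And>x. x \<in> space M \<Longrightarrow> 0 \<le> g x"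
    and "\<And>x. x \<in> space M \<Longrightarrow> (h x)\<^sup>2 = f x * g x"
  shows "(\<integral>x. h x \<partial>M)\<^sup>2 \<le> (\<integral>x. f x \<partial>M) * (\<integral>x. g x \<partial>M)"
proof -
  let ?F = "\<integral>x. f x \<partial>M" and ?G = "\<integral>x. g x \<partial>M" and ?H = "\<integral>x. h x \<partial>M"
  \<comment> \<open>The discriminant argument: the integrand is nonnegative because |h| = sqrt f *
    sqrt g, so |2 c h| <= c^2 f + g by completing the square.\<close>
  have quadratic: "0 \<le> c\<^sup>2 * ?F - 2 * c * ?H + ?G" for c :: real
  proof -
    have "0 \<le> c\<^sup>2 * f x - 2 * c * h x + g x" if x: "x \<in> space M" for x
    proof -
      have "\<bar>h x\<bar> = sqrt (f x) * sqrt (g x)"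
        using assms(6)[OF x] by (metis real_sqrt_abs real_sqrt_mult)
      moreover have "0 \<le> (\<bar>c\<bar> * sqrt (f x) - sqrt (g x))\<^sup>2" by simp
      ultimately have "2 * \<bar>c * h x\<bar> \<le> c\<^sup>2 * f x + g x"
        using assms(4,5)[OF x] by (simp add: power2_diff power_mult_distrib abs_mult mult_ac)
      then show ?thesis by (simp add: abs_le_iff)
    qed
    then have "0 \<le> (\<integral>x. c\<^sup>2 * f x - 2 * c * h x + g x \<partial>M)"
      by (rule Bochner_Integration.integral_nonneg)
    then show ?thesis using assms(1-3) by simp
  qed
  have F: "?F \<ge> 0" using assms(4) by (rule Bochner_Integration.integral_nonneg)
  show ?thesis
  proof (cases "?F = 0")
    case True
    have "?H = 0"
    proof (rule ccontr)
      assume "?H \<noteq> 0"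
      \<comment> \<open>For F = 0 the quadratic is the linear function G - 2 c H, and this c makes
        it -1.\<close>
      with quadratic[of "(?G + 1) / (2 * ?H)"] True show False by simp
    qed
    with True show ?thesis by simp
  next
    case False
    \<comment> \<open>c = H/F minimises the quadratic; the minimum is G - H^2/F.\<close>
    with F quadratic[of "?H / ?F"] show ?thesis
      by (simp add: field_simps power2_eq_square)
  qed
qed

section \<open>The simplex and the Dirichlet kernel\<close>

lemma full_coords_nonneg: "t \<in> E_simplex \<Longrightarrow> full_coords t $ i \<ge> 0"
  by (cases i) (auto simp: full_coords_def E_simplex_def)

lemma coord_prod_nonneg: "t \<in> E_simplex \<Longrightarrow> coord_prod t \<ge> 0"
  by (simp add: coord_prod_def prod_nonneg full_coords_nonneg)

lemma borel_measurable_full_coords [measurable]: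
  "(\<lambda>t :: real ^ 'm::finite. full_coords t $ i) \<in> borel_measurable borel"
  by (cases i) (auto simp: full_coords_def intro!: borel_measurable_continuous_onI continuous_intros)

lemma borel_measurable_coord_prod [measurable]:
  "(coord_prod :: real ^ 'm::finite \<Rightarrow> real) \<in> borel_measurable borel"
  unfolding coord_prod_def[abs_def] by measurable

lemma E_simplex_borel [measurable]: "(E_simplex :: (real ^ 'm::finite) set) \<in> sets borel"
proof -
  have "closed (E_simplex :: (real ^ 'm) set)"
    unfolding E_simplex_def
    by (intro closed_Collect_conj closed_Collect_all closed_Collect_le continuous_intros)
  then show ?thesis by (rule borel_closed)
qed

text \<open>The unnormalised Dirichlet density with parameters \<open>\<phi> $ i / k\<close>. It
  carries the whole dependence of the integrand on \<open>\<phi>\<close>.\<close>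

definition dirichlet_kernel :: "real \<Rightarrow> real ^ 'm option \<Rightarrow> real ^ 'm::finite \<Rightarrow> real" where
  "dirichlet_kernel k \<phi> t = (\<Prod>i\<in>UNIV. full_coords t $ i powr (\<phi> $ i / k - 1))"

lemma dirichlet_kernel_nonneg: "dirichlet_kernel k \<phi> t \<ge> 0"
  by (simp add: dirichlet_kernel_def prod_nonneg)

lemma borel_measurable_dirichlet_kernel [measurable]:
  "dirichlet_kernel k \<phi> \<in> borel_measurable borel"
  unfolding dirichlet_kernel_def[abs_def] by measurable

text \<open>A factor \<open>0 powr y\<close> is 0 even for negative y, where the classical density
  blows up. This makes the pointwise claims trivial on the boundary.\<close>

lemma dirichlet_kernel_boundary:
  "full_coords t $ i = 0 \<Longrightarrow> dirichlet_kernel k \<phi> t = 0"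
  by (auto simp: dirichlet_kernel_def intro!: bexI[of _ i])

text \<open>Exhibits the logarithm of the kernel as an affine function of \<open>\<phi>\<close>, the
  source of both the midpoint identity and convexity.\<close>

lemma dirichlet_kernel_interior:
  assumes "\<And>i. full_coords t $ i > 0"
  shows "dirichlet_kernel k \<phi> t = exp (\<Sum>i\<in>UNIV. (\<phi> $ i / k - 1) * ln (full_coords t $ i))"
  using assms by (simp add: dirichlet_kernel_def powr_def exp_sum less_imp_neq[THEN not_sym])

text \<open>Twice the exponent (x + y)/k - 1 is the sum of 2x/k - 1 and 2y/k - 1.\<close>

lemma dirichlet_kernel_midpoint:
  assumes "t \<in> E_simplex"
  shows "(dirichlet_kernel k (\<phi> + \<psi>) t)\<^sup>2 =
    dirichlet_kernel k (2 *\<^sub>R \<phi>) t * dirichlet_kernel k (2 *\<^sub>R \<psi>) t"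
proof (cases "\<exists>i. full_coords t $ i = 0")
  case True
  then show ?thesis by (auto simp: dirichlet_kernel_boundary)
next
  case False
  with full_coords_nonneg[OF assms] have pos: "full_coords t $ i > 0" for i
    by (metis less_eq_real_def)
  show ?thesis
    unfolding dirichlet_kernel_interior[OF pos]
    by (simp add: exp_add[symmetric] power2_eq_square sum.distrib[symmetric] algebra_simps add_divide_distrib)
qed

text \<open>In the interior the kernel is \<open>exp\<close> composed with an affine function of
  \<open>\<phi>\<close>; on the boundary it is identically 0.\<close>

lemma dirichlet_kernel_convex:
  assumes "t \<in> E_simplex"
  shows "convex_on UNIV (\<lambda>\<phi>. dirichlet_kernel k \<phi> t)"
proof (cases "\<exists>i. full_coords t $ i = 0")
  case True
  then show ?thesis by (auto simp: dirichlet_kernel_boundary convex_on_def)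
next
  case False
  with full_coords_nonneg[OF assms] have pos: "full_coords t $ i > 0" for i
    by (metis less_eq_real_def)
  let ?L = "\<lambda>\<phi>. \<Sum>i\<in>UNIV. (\<phi> $ i / k - 1) * ln (full_coords t $ i)"
  show ?thesis
    unfolding dirichlet_kernel_interior[OF pos]
  proof (rule convex_onI)
    fix u :: real and \<phi> \<psi> :: "real ^ 'a option"
    assume u: "0 < u" "u < 1"
    have "?L ((1 - u) *\<^sub>R \<phi> + u *\<^sub>R \<psi>) = (1 - u) * ?L \<phi> + u * ?L \<psi>"
      by (simp add: sum_distrib_left sum.distrib[symmetric] algebra_simps add_divide_distrib diff_divide_distrib)
    then show "exp (?L ((1 - u) *\<^sub>R \<phi> + u *\<^sub>R \<psi>)) \<le> (1 - u) * exp (?L \<phi>) + u * exp (?L \<psi>)"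
      using convex_onD[OF exp_convex, of u "?L \<phi>" "?L \<psi>"] u by simp
  qed simp
qed

text \<open>On the simplex the kernel coincides with the product of \<open>pos_powr\<close> factors,
  where \<open>None\<close> carries the last coordinate. That product is a majorant of finite
  integral for any weight bounded by 1.\<close>

lemma dirichlet_kernel_integrable:
  fixes w :: "real ^ 'm::finite \<Rightarrow> real"
  assumes "k > 0" "\<phi> \<in> pos_orthant" and [measurable]: "w \<in> borel_measurable borel"
    and w: "\<And>t. t \<in> E_simplex \<Longrightarrow> \<bar>w t\<bar> \<le> 1"
  shows "integrable lborel (\<lambda>t. indicator E_simplex t * (dirichlet_kernel k \<phi> t * w t))"
proof (rule integrableI_bounded)
  let ?D = "\<lambda>t :: real ^ 'm. (\<Prod>i\<in>UNIV. pos_powr (\<phi> $ Some i / k) (t $ i)) *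
    pos_powr (\<phi> $ None / k) (1 - (\<Sum>i\<in>UNIV. t $ i))"
  have "norm (indicator E_simplex t * (dirichlet_kernel k \<phi> t * w t)) \<le> ?D t" for t
  proof (cases "t \<in> E_simplex")
    case True
    have "dirichlet_kernel k \<phi> t = (\<Prod>i\<in>UNIV. pos_powr (\<phi> $ i / k) (full_coords t $ i))"
      using full_coords_nonneg[OF True] by (simp add: dirichlet_kernel_def pos_powr_eq)
    also have "\<dots> = ?D t"
      by (simp add: UNIV_option_conv full_coords_def prod.reindex mult.commute)
    finally have "dirichlet_kernel k \<phi> t = ?D t" .
    moreover have "norm (indicator E_simplex t * (dirichlet_kernel k \<phi> t * w t)) \<le> dirichlet_kernel k \<phi> t"
      using True dirichlet_kernel_nonneg[of k \<phi> t] by (simp add: abs_mult mult_left_le w)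
    ultimately show ?thesis by (simp only:)
  qed (simp add: prod_nonneg)
  then have "(\<integral>\<^sup>+t. ennreal (norm (indicator E_simplex t * (dirichlet_kernel k \<phi> t * w t))) \<partial>lborel)
      \<le> (\<integral>\<^sup>+t. ennreal (?D t) \<partial>lborel)"
    by (intro nn_integral_mono ennreal_leI)
  also have "\<dots> < \<infinity>"
    by (rule nn_integral_Dirichlet_finite) (use assms(1,2) in \<open>auto simp: pos_orthant_def\<close>)
  finally show "(\<integral>\<^sup>+t. ennreal (norm (indicator E_simplex t * (dirichlet_kernel k \<phi> t * w t))) \<partial>lborel) < \<infinity>" .
qed measurable

section \<open>Convexity of the orthant and the two claims for the beta k-function\<close>

lemma convex_pos_orthant: "convex (pos_orthant :: (real ^ 'n) set)"
proof -
  have "pos_orthant = (\<Inter>i. {\<phi> :: real ^ 'n. 0 < \<phi> $ i})"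
    by (auto simp: pos_orthant_def)
  moreover have "convex {\<phi> :: real ^ 'n. 0 < \<phi> $ i}" for i
    using convex_halfspace_gt[of 0 "axis i 1 :: real ^ 'n"] by (simp add: inner_axis inner_commute)
  ultimately show ?thesis using convex_INT[of UNIV "\<lambda>i. {\<phi> :: real ^ 'n. 0 < \<phi> $ i}"] by (metis UNIV_I)
qed

theorem theorem2p1:
  fixes k a b \<eta> \<zeta> :: real
  assumes "k > 0" and "a > 0" and "b - a > 0" and "\<eta> > 0" and "\<zeta> \<ge> 0"
  shows "(\<forall>\<phi> \<in> pos_orthant. \<forall>\<psi> \<in> pos_orthant.
            (gen_beta_k \<zeta> k a b (\<phi> + \<psi> :: real ^ ('m::finite) option) \<eta>)\<^sup>2
              \<le> gen_beta_k \<zeta> k a b (2 *\<^sub>R \<phi>) \<eta> * gen_beta_k \<zeta> k a b (2 *\<^sub>R \<psi>) \<eta>)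
       \<and> convex_on (pos_orthant :: (real ^ ('m::finite) option) set) (\<lambda>\<phi>. gen_beta_k \<zeta> k a b \<phi> \<eta>)"
proof -
  define w where "w = (\<lambda>t :: real ^ 'm. hyp1F1_k k a b
    (- (\<eta> powr k / (k * coord_prod t)) - \<zeta> powr k * (coord_prod t / \<eta> powr k)))"
  define G where "G = (\<lambda>(\<phi> :: real ^ 'm option) t. indicator E_simplex t * (dirichlet_kernel k \<phi> t * w t))"
  have w_meas: "w \<in> borel_measurable borel"
    unfolding w_def by measurable
  have w_nonneg: "w t \<ge> 0" for t
    unfolding w_def by (rule hyp1F1_k_nonneg[OF assms(1-3)])
  have w_le: "w t \<le> 1" if "t \<in> E_simplex" for t
    unfolding w_def
  proof (rule hyp1F1_k_le_1[OF assms(1-3)])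
    \<comment> \<open>If \<open>coord_prod t = 0\<close>, division by zero yields 0 and the argument
      itself is 0, so the bound also covers the boundary.\<close>
    have "0 \<le> \<eta> powr k / (k * coord_prod t)" "0 \<le> \<zeta> powr k * (coord_prod t / \<eta> powr k)"
      using coord_prod_nonneg[OF that] assms(1) by simp_all
    then show "- (\<eta> powr k / (k * coord_prod t)) - \<zeta> powr k * (coord_prod t / \<eta> powr k) \<le> 0"
      by linarith
  qed
  have beta_eq: "gen_beta_k \<zeta> k a b \<phi> \<eta> = 1 / k ^ CARD('m) * (\<integral>t. G \<phi> t \<partial>lborel)" for \<phi> :: "real ^ 'm option"
    by (simp add: gen_beta_k_def set_lebesgue_integral_def G_def dirichlet_kernel_def w_def)
  have G_int: "integrable lborel (G \<phi>)" if "\<phi> \<in> pos_orthant" for \<phi>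
    unfolding G_def using assms(1) that w_meas
    by (rule dirichlet_kernel_integrable) (simp add: w_nonneg w_le)
  have G_nonneg: "G \<phi> t \<ge> 0" for \<phi> t
    by (simp add: G_def dirichlet_kernel_nonneg w_nonneg)
  show ?thesis
  proof (intro conjI ballI)
    fix \<phi> \<psi> :: "real ^ 'm option"
    assume \<phi>\<psi>: "\<phi> \<in> pos_orthant" "\<psi> \<in> pos_orthant"
    then have *: "\<phi> + \<psi> \<in> pos_orthant" "2 *\<^sub>R \<phi> \<in> pos_orthant" "2 *\<^sub>R \<psi> \<in> pos_orthant"
      by (auto simp: pos_orthant_def add_pos_pos)
    \<comment> \<open>The indicator and \<open>w t\<close> enter squared on both sides, which leaves
      the midpoint identity of the kernel.\<close>
    have "(G (\<phi> + \<psi>) t)\<^sup>2 = G (2 *\<^sub>R \<phi>) t * G (2 *\<^sub>R \<psi>) t" for t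
      by (cases "t \<in> E_simplex")
         (simp_all add: G_def power_mult_distrib dirichlet_kernel_midpoint, simp add: power2_eq_square)
    then have "(\<integral>t. G (\<phi> + \<psi>) t \<partial>lborel)\<^sup>2 \<le> (\<integral>t. G (2 *\<^sub>R \<phi>) t \<partial>lborel) * (\<integral>t. G (2 *\<^sub>R \<psi>) t \<partial>lborel)"
      by (intro integral_Cauchy_Schwarz G_int * G_nonneg)
    then have "(1 / k ^ CARD('m))\<^sup>2 * (\<integral>t. G (\<phi> + \<psi>) t \<partial>lborel)\<^sup>2 \<le>
        (1 / k ^ CARD('m))\<^sup>2 * ((\<integral>t. G (2 *\<^sub>R \<phi>) t \<partial>lborel) * (\<integral>t. G (2 *\<^sub>R \<psi>) t \<partial>lborel))"
      by (intro mult_left_mono) simp_all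
    then show "(gen_beta_k \<zeta> k a b (\<phi> + \<psi>) \<eta>)\<^sup>2
        \<le> gen_beta_k \<zeta> k a b (2 *\<^sub>R \<phi>) \<eta> * gen_beta_k \<zeta> k a b (2 *\<^sub>R \<psi>) \<eta>"
      unfolding beta_eq by (simp add: power2_eq_square mult_ac)
  next
    have "convex_on pos_orthant (\<lambda>\<phi>. \<integral>t. G \<phi> t \<partial>lborel)"
    proof (rule convex_onI[OF _ convex_pos_orthant])
      fix u :: real and \<phi> \<psi> :: "real ^ 'm option"
      assume u: "0 < u" "u < 1" and \<phi>\<psi>: "\<phi> \<in> pos_orthant" "\<psi> \<in> pos_orthant"
      \<comment> \<open>Provides integrability at the convex combination, so that the pointwise
        inequality can be integrated.\<close>
      then have mem: "(1 - u) *\<^sub>R \<phi> + u *\<^sub>R \<psi> \<in> pos_orthant"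
        by (intro convexD[OF convex_pos_orthant]) auto
      have "G ((1 - u) *\<^sub>R \<phi> + u *\<^sub>R \<psi>) t \<le> (1 - u) * G \<phi> t + u * G \<psi> t" for t
      proof (cases "t \<in> E_simplex")
        case True
        from convex_onD[OF dirichlet_kernel_convex[OF this], of u \<phi> \<psi> k] u
        have "dirichlet_kernel k ((1 - u) *\<^sub>R \<phi> + u *\<^sub>R \<psi>) t * w t \<le>
            ((1 - u) * dirichlet_kernel k \<phi> t + u * dirichlet_kernel k \<psi> t) * w t"
          by (intro mult_right_mono w_nonneg) simp
        with True show ?thesis by (simp add: G_def algebra_simps)
      qed (simp add: G_def)
      then have "(\<integral>t. G ((1 - u) *\<^sub>R \<phi> + u *\<^sub>R \<psi>) t \<partial>lborel) \<le>
          (\<integral>t. (1 - u) * G \<phi> t + u * G \<psi> t \<partial>lborel)"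
        by (intro integral_mono) (simp_all add: G_int mem \<phi>\<psi>)
      then show "(\<integral>t. G ((1 - u) *\<^sub>R \<phi> + u *\<^sub>R \<psi>) t \<partial>lborel) \<le>
          (1 - u) * (\<integral>t. G \<phi> t \<partial>lborel) + u * (\<integral>t. G \<psi> t \<partial>lborel)"
        by (simp add: G_int \<phi>\<psi>)
    qed
    then show "convex_on pos_orthant (\<lambda>\<phi> :: real ^ 'm option. gen_beta_k \<zeta> k a b \<phi> \<eta>)"
      unfolding beta_eq using assms(1) by (intro convex_on_cmul) simp_all
  qed
qed

end
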